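(* Let $M\ge 0$ and let $u_M(x,t,\xi)=\sum_{i=0}^M \phi_i(\xi)\,\hat u_i(x,t)^{\mathrm T}$ be the gPC approximation with coefficient row vectors $\hat u_i(x,t)\in\mathbb{R}^{N}$. If $u_M(x,t,\xi)\in\mathcal G$ for all $\xi\in\Theta$, then the matrix $\hat A_0$ is real symmetric and positive definite, and the matrix $\hat A_1$ is real symmetric; that is, the gPC stochastic Galerkin system $$\hat A_0\,\frac{\partial}{\partial t}\hat U(x,t)+\hat A_1\,\frac{\partial}{\partial x}\hat U(x,t)=0,\qquad \hat U=(\hat u_0,\dots,\hat u_M)^{\mathrm T}\in\mathbb{R}^{(M+1)N},$$ is symmetrically hyperbolic.
   Context: Hyperbolic system with uncertainty: consider $\partial_t U(x,t,\xi)+\partial_x F(U(x,t,\xi);\xi)=0$, $x\in\Omega\subseteq\mathbb{R}$, $t>0$, with unknown $U\in\mathbb{R}^N$, flux $F(U;\xi)\in\mathbb{R}^N$, and random variables $\xi\in\Theta\subset\mathbb{R}^d$ with probability distribution $\mu$. Let $\mathcal G\subseteq\mathbb{R}^N$ be the set of admissible states. The system is assumed hyperbolic: the Jacobian $A(U;\xi)=\partial F(U;\xi)/\partial U\in\mathbb{R}^{N\times N}$ is real diagonalizable for all $U\in\mathcal G$ and almost every $\xi\in\Theta$. Symmetrization: for $U\in\mathcal G$ and a.e. $\xi\in\Theta$, let $L(U;\xi)\in\mathbb{R}^{N\times N}$ be an invertible left eigenvector matrix of $A(U;\xi)$, so that $A=L^{-1}\Lambda L$ with $\Lambda=\mathrm{diag}\{\lambda_1,\dots,\lambda_N\}$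 the real diagonal matrix of eigenvalues of $A(U;\xi)$. Set $$A_0(U;\xi):=L^{\mathrm T}L,\qquad A_1(U;\xi):=L^{\mathrm T}\Lambda L .$$ gPC basis: $\{\phi_i\}_{i\ge 0}$ is a complete set of real polynomials in $d$ variables, orthonormal in the sense $\int_\Theta\phi_i\phi_j\,d\mu=\delta_{ij}$. Galerkin matrices: for $k=0,1$, $\hat A_k\in\mathbb{R}^{(M+1)N\times(M+1)N}$ is the block matrix with $N\times N$ blocks $$\hat A^{(k)}_{ij}=\int_\Theta \phi_i(\xi)\phi_j(\xi)\,A_k(u_M(x,t,\xi);\xi)\,d\mu(\xi),\qquad i,j=0,\dots,M.$$ The integrands are assumed measurable and these integrals are assumed to exist (finite). A linear-in-derivatives system $\hat A_0\partial_t\hat U+\hat A_1\partial_x\hat U=0$ is called symmetrically hyperbolic when $\hat A_0$ is real symmetric positive definite and $\hat A_1$ is real symmetric. *)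

theory Defs
  imports "HOL-Analysis.Analysis" "HOL-Probability.Probability"
begin

section \<open>Linear algebra\<close>

definition diag_mat :: "real ^ 'n \<Rightarrow> real ^ 'n ^ 'n" where
  "diag_mat l = (\<chi> i j. if i = j then l $ i else 0)"

definition real_diagonalizable :: "real ^ 'n ^ 'n \<Rightarrow> bool" where
  "real_diagonalizable A \<longleftrightarrow>
     (\<exists>(P :: real ^ 'n ^ 'n) l. invertible P \<and> A = matrix_inv P ** diag_mat l ** P)"

text \<open>The rows of \<open>L\<close> are left eigenvectors of \<open>A\<close> for the eigenvalues listed in \<open>l\<close>.\<close>

definition left_eigenvector_matrix ::
    "real ^ 'n ^ 'n \<Rightarrow> real ^ 'n ^ 'n \<Rightarrow> real ^ 'n \<Rightarrow> bool" where
  "left_eigenvector_matrix A L l \<longleftrightarrow>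
     invertible L \<and> A = matrix_inv L ** diag_mat l ** L"

definition symmetric_mat :: "real ^ 'n ^ 'n \<Rightarrow> bool" where
  "symmetric_mat A \<longleftrightarrow> transpose A = A"

definition positive_definite_mat :: "real ^ 'n ^ 'n \<Rightarrow> bool" where
  "positive_definite_mat A \<longleftrightarrow> (\<forall>v. v \<noteq> 0 \<longrightarrow> v \<bullet> (A *v v) > 0)"

text \<open>A system \<open>B\<^sub>0 \<partial>\<^sub>t V + B\<^sub>1 \<partial>\<^sub>x V = 0\<close> is represented by its coefficient matrices
  at the point under consideration.\<close>

definition symmetrically_hyperbolic :: "real ^ 'k ^ 'k \<Rightarrow> real ^ 'k ^ 'k \<Rightarrow> bool" where
  "symmetrically_hyperbolic B0 B1 \<longleftrightarrow>
     symmetric_mat B0 \<and> positive_definite_mat B0 \<and> symmetric_mat B1"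


section \<open>Hyperbolic systems with uncertainty\<close>

definition flux_jacobian ::
    "(real ^ 'n \<Rightarrow> 'p \<Rightarrow> real ^ 'n) \<Rightarrow> real ^ 'n \<Rightarrow> 'p \<Rightarrow> real ^ 'n ^ 'n" where
  "flux_jacobian F U \<xi> = jacobian (\<lambda>V. F V \<xi>) (at U)"

text \<open>The exceptional null set of parameters does not depend on the state \<open>U\<close>; this is needed
  because the state substituted later, \<open>u\<^sub>M(x,t,\<xi>)\<close>, itself depends on \<open>\<xi>\<close>.\<close>

definition hyperbolic_flux ::
    "'p measure \<Rightarrow> (real ^ 'n) set \<Rightarrow> (real ^ 'n \<Rightarrow> 'p \<Rightarrow> real ^ 'n) \<Rightarrow> bool" where
  "hyperbolic_flux \<mu> G F \<longleftrightarrow>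
     (AE \<xi> in \<mu>. \<forall>U\<in>G. (\<lambda>V. F V \<xi>) differentiable (at U) \<and>
                       real_diagonalizable (flux_jacobian F U \<xi>))"

definition symmetrizer0 ::
    "(real ^ 'n \<Rightarrow> 'p \<Rightarrow> real ^ 'n ^ 'n) \<Rightarrow> real ^ 'n \<Rightarrow> 'p \<Rightarrow> real ^ 'n ^ 'n" where
  "symmetrizer0 L U \<xi> = transpose (L U \<xi>) ** L U \<xi>"

definition symmetrizer1 ::
    "(real ^ 'n \<Rightarrow> 'p \<Rightarrow> real ^ 'n ^ 'n) \<Rightarrow> (real ^ 'n \<Rightarrow> 'p \<Rightarrow> real ^ 'n) \<Rightarrow>
     real ^ 'n \<Rightarrow> 'p \<Rightarrow> real ^ 'n ^ 'n" where
  "symmetrizer1 L lam U \<xi> = transpose (L U \<xi>) ** diag_mat (lam U \<xi>) ** L U \<xi>"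


section \<open>Generalized polynomial chaos\<close>

text \<open>Completeness is completeness in \<open>L\<^sup>2(\<mu>)\<close>: finite linear combinations of the \<open>\<phi>\<^sub>i\<close> are dense.\<close>

definition gpc_basis ::
    "(real ^ 'd) measure \<Rightarrow> (nat \<Rightarrow> real ^ 'd \<Rightarrow> real) \<Rightarrow> bool" where
  "gpc_basis \<mu> \<phi> \<longleftrightarrow>
     (\<forall>i. real_polynomial_function (\<phi> i)) \<and>
     (\<forall>i j. has_bochner_integral \<mu> (\<lambda>\<xi>. \<phi> i \<xi> * \<phi> j \<xi>) (if i = j then 1 else 0)) \<and>
     (\<forall>f \<in> borel_measurable \<mu>. integrable \<mu> (\<lambda>\<xi>. (f \<xi>)\<^sup>2) \<longrightarrow>
        (\<forall>\<epsilon>>0. \<exists>n c. (LINT \<xi>|\<mu>. (f \<xi> - (\<Sum>i<n. c i * \<phi> i \<xi>))\<^sup>2) < \<epsilon>))"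

definition gpc_approx ::
    "nat \<Rightarrow> (nat \<Rightarrow> real ^ 'd \<Rightarrow> real) \<Rightarrow> (nat \<Rightarrow> real \<Rightarrow> real \<Rightarrow> real ^ 'n) \<Rightarrow>
     real \<Rightarrow> real \<Rightarrow> real ^ 'd \<Rightarrow> real ^ 'n" where
  "gpc_approx M \<phi> u x t \<xi> = (\<Sum>i\<le>M. \<phi> i \<xi> *\<^sub>R u i x t)"

definition galerkin_integrand ::
    "(nat \<Rightarrow> 'p \<Rightarrow> real) \<Rightarrow> ('p \<Rightarrow> real ^ 'n ^ 'n) \<Rightarrow> nat \<Rightarrow> nat \<Rightarrow> 'p \<Rightarrow> real ^ 'n ^ 'n" where
  "galerkin_integrand \<phi> B i j \<xi> = (\<phi> i \<xi> * \<phi> j \<xi>) *\<^sub>R B \<xi>"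

definition galerkin_block ::
    "'p measure \<Rightarrow> (nat \<Rightarrow> 'p \<Rightarrow> real) \<Rightarrow> ('p \<Rightarrow> real ^ 'n ^ 'n) \<Rightarrow> nat \<Rightarrow> nat \<Rightarrow> real ^ 'n ^ 'n"
  where
  "galerkin_block \<mu> \<phi> B i j = (LINT \<xi>|\<mu>. galerkin_integrand \<phi> B i j \<xi>)"

text \<open>Block matrices of size \<open>(M+1)N\<close> are indexed by the type \<open>'m \<times> 'n\<close> (block number, position
  within the block).  The blocks are numbered \<open>0,\<dots>,M\<close> by a bijection \<open>blk\<close> from \<open>'m\<close> onto
  \<open>{..M}\<close>, so that \<open>CARD('m) = M + 1\<close>.\<close>

definition galerkin_matrix ::
    "('m::finite \<Rightarrow> nat) \<Rightarrow> 'p measure \<Rightarrow> (nat \<Rightarrow> 'p \<Rightarrow> real) \<Rightarrow>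
     ('p \<Rightarrow> real ^ 'n ^ 'n) \<Rightarrow> real ^ ('m \<times> 'n) ^ ('m \<times> 'n)" where
  "galerkin_matrix blk \<mu> \<phi> B =
     (\<chi> p q. galerkin_block \<mu> \<phi> B (blk (fst p)) (blk (fst q)) $ snd p $ snd q)"

end

theory Submission
  imports Defs
begin

text \<open>The Galerkin matrix of a matrix-valued function \<open>B\<close> is the matrix of the quadratic form
  \<open>v \<mapsto> \<integral> w\<^sub>v \<bullet> B w\<^sub>v \<partial>\<mu>\<close>, where \<open>w\<^sub>v(\<xi>) = \<Sum>\<^sub>i \<phi>\<^sub>i(\<xi>) v\<^sub>i\<close> is the random vector whose chaos
  coefficients are the blocks of \<open>v\<close> (\<open>galerkin_quadratic_form\<close>).  This makes the properties of \<open>B\<close>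
  pass to its Galerkin matrix.  Symmetry is inherited because both \<open>\<phi>\<^sub>i \<phi>\<^sub>j\<close> and \<open>B\<close> are symmetric
  (\<open>symmetric_galerkin_matrix\<close>).  If \<open>B\<close> is almost everywhere positive definite, the form is
  nonnegative, and it vanishes only if \<open>w\<^sub>v = 0\<close> almost everywhere; then \<open>v = 0\<close>, since the blocks of
  \<open>v\<close> are recovered from \<open>w\<^sub>v\<close> by orthonormality (\<open>positive_definite_galerkin_matrix\<close>).

  The matrices \<open>L\<^sup>TL\<close> and \<open>L\<^sup>T\<Lambda>L\<close> are symmetric by their form, and \<open>L\<^sup>TL\<close> is positive definite
  because \<open>v \<bullet> L\<^sup>TL v = \<parallel>L v\<parallel>\<^sup>2\<close> and \<open>L\<close> is invertible.  The exceptional null set of parameters is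
  the same for all states, so these facts may be applied at the parameter-dependent state
  \<open>u\<^sub>M(x,t,\<xi>)\<close>.\<close>

lemma symmetric_mat_congruence:
  fixes S L :: "real ^ 'n ^ 'n"
  assumes "symmetric_mat S"
  shows "symmetric_mat (transpose L ** S ** L)"
  using assms by (simp add: symmetric_mat_def matrix_transpose_mul matrix_mul_assoc)

lemma symmetric_symmetrizer0: "symmetric_mat (symmetrizer0 L U \<xi>)"
  by (simp add: symmetrizer0_def symmetric_mat_def matrix_transpose_mul)

lemma symmetric_symmetrizer1: "symmetric_mat (symmetrizer1 L lam U \<xi>)"
  unfolding symmetrizer1_def
  by (rule symmetric_mat_congruence) (auto simp: symmetric_mat_def diag_mat_def transpose_def vec_eq_iff)

lemma positive_definite_symmetrizer0:
  assumes "invertible (L U \<xi>)"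
  shows "positive_definite_mat (symmetrizer0 L U \<xi>)"
  unfolding positive_definite_mat_def
proof (intro allI impI)
  fix v :: "real ^ 'a" assume "v \<noteq> 0"
  have "symmetrizer0 L U \<xi> *v v = (L U \<xi> *v v) v* L U \<xi>"
    by (simp only: symmetrizer0_def matrix_vector_mul_assoc[symmetric] transpose_matrix_vector)
  then have "v \<bullet> (symmetrizer0 L U \<xi> *v v) = (L U \<xi> *v v) \<bullet> (L U \<xi> *v v)"
    by (simp only: inner_commute[of v "_ v* _"] dot_lmul_matrix)
  moreover have "L U \<xi> *v v \<noteq> 0"
    using assms \<open>v \<noteq> 0\<close> by (metis invertible_def matrix_left_invertible_ker)
  ultimately show "v \<bullet> (symmetrizer0 L U \<xi> *v v) > 0" by simp
qed

lemma
  fixes blk :: "'m::finite \<Rightarrow> nat" and B :: "'p \<Rightarrow> real ^ 'n ^ 'n"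
  assumes "\<And>a b. integrable \<mu> (galerkin_integrand \<phi> B (blk a) (blk b))"
  shows integrable_galerkin_entry:
      "integrable \<mu> (\<lambda>\<xi>. \<phi> (blk a) \<xi> * \<phi> (blk b) \<xi> * B \<xi> $ k $ l)"
    and galerkin_matrix_entry:
      "galerkin_matrix blk \<mu> \<phi> B $ (a, k) $ (b, l) =
         (LINT \<xi>|\<mu>. \<phi> (blk a) \<xi> * \<phi> (blk b) \<xi> * B \<xi> $ k $ l)"
proof -
  have lin: "bounded_linear (\<lambda>X :: real ^ 'n ^ 'n. X $ k $ l)"
    by (intro bounded_linear_compose[OF bounded_linear_vec_nth bounded_linear_vec_nth])
  have int: "integrable \<mu> (galerkin_integrand \<phi> B (blk a) (blk b))"
    using assms by blast
  show "integrable \<mu> (\<lambda>\<xi>. \<phi> (blk a) \<xi> * \<phi> (blk b) \<xi> * B \<xi> $ k $ l)"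
    using integrable_bounded_linear[OF lin int] by (simp add: galerkin_integrand_def)
  show "galerkin_matrix blk \<mu> \<phi> B $ (a, k) $ (b, l) =
         (LINT \<xi>|\<mu>. \<phi> (blk a) \<xi> * \<phi> (blk b) \<xi> * B \<xi> $ k $ l)"
    using integral_bounded_linear[OF lin int]
    by (simp add: galerkin_matrix_def galerkin_block_def) (simp add: galerkin_integrand_def)
qed

lemma symmetric_galerkin_matrix:
  fixes blk :: "'m::finite \<Rightarrow> nat" and B :: "'p \<Rightarrow> real ^ 'n ^ 'n"
  assumes int: "\<And>a b. integrable \<mu> (galerkin_integrand \<phi> B (blk a) (blk b))"
    and sym: "AE \<xi> in \<mu>. symmetric_mat (B \<xi>)"
  shows "symmetric_mat (galerkin_matrix blk \<mu> \<phi> B)"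
proof -
  have "galerkin_matrix blk \<mu> \<phi> B $ (b, l) $ (a, k) = galerkin_matrix blk \<mu> \<phi> B $ (a, k) $ (b, l)"
    for a b :: 'm and k l :: 'n
    unfolding galerkin_matrix_entry[where blk = blk and B = B, OF int]
  proof (rule integral_cong_AE)
    show "AE \<xi> in \<mu>. \<phi> (blk b) \<xi> * \<phi> (blk a) \<xi> * B \<xi> $ l $ k =
                     \<phi> (blk a) \<xi> * \<phi> (blk b) \<xi> * B \<xi> $ k $ l"
      using sym
    proof eventually_elim
      case (elim \<xi>)
      then have "B \<xi> $ l $ k = B \<xi> $ k $ l"
        by (auto simp: symmetric_mat_def transpose_def vec_eq_iff)
      then show ?case by simp
    qed
  qed (use integrable_galerkin_entry[where blk = blk and B = B, OF int] in
        \<open>auto intro: borel_measurable_integrable\<close>)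
  then show ?thesis
    by (auto simp: symmetric_mat_def transpose_def vec_eq_iff)
qed

text \<open>The random vector \<open>w\<^sub>v\<close>: the blocks of \<open>v\<close> are its coefficients in the chaos expansion.\<close>

definition chaos_vector ::
    "('m::finite \<Rightarrow> nat) \<Rightarrow> (nat \<Rightarrow> 'p \<Rightarrow> real) \<Rightarrow> real ^ ('m \<times> 'n::finite) \<Rightarrow> 'p \<Rightarrow> real ^ 'n" where
  "chaos_vector blk \<phi> v \<xi> = (\<chi> k. \<Sum>a\<in>UNIV. \<phi> (blk a) \<xi> * v $ (a, k))"

lemma chaos_vector_quadratic_form:
  fixes blk :: "'m::finite \<Rightarrow> nat" and v :: "real ^ ('m \<times> 'n::finite)" and X :: "real ^ 'n ^ 'n"
  shows "chaos_vector blk \<phi> v \<xi> \<bullet> (X *v chaos_vector blk \<phi> v \<xi>) =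
     (\<Sum>(a, k)\<in>UNIV. \<Sum>(b, l)\<in>UNIV.
        v $ (a, k) * v $ (b, l) * (\<phi> (blk a) \<xi> * \<phi> (blk b) \<xi> * X $ k $ l))"
proof -
  define w where "w = chaos_vector blk \<phi> v \<xi>"
  have sum_pairs: "(\<Sum>p\<in>UNIV. f p) = (\<Sum>a\<in>UNIV. \<Sum>k\<in>UNIV. f (a, k))"
    for f :: "'m \<times> 'n \<Rightarrow> real"
    by (simp add: sum.cartesian_product flip: UNIV_Times_UNIV)
  have w: "w $ k = (\<Sum>a\<in>UNIV. \<phi> (blk a) \<xi> * v $ (a, k))" for k
    by (simp add: w_def chaos_vector_def)
  have "(X *v w) $ k = (\<Sum>l\<in>UNIV. \<Sum>b\<in>UNIV. X $ k $ l * (\<phi> (blk b) \<xi> * v $ (b, l)))" for k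
    by (simp only: matrix_vector_mul_component inner_vec_def inner_real_def w sum_distrib_left)
  then have Xw: "(X *v w) $ k = (\<Sum>(b, l)\<in>UNIV. X $ k $ l * (\<phi> (blk b) \<xi> * v $ (b, l)))" for k
    by (simp only: sum_pairs prod.case) (rule sum.swap)
  have "w \<bullet> (X *v w) = (\<Sum>k\<in>UNIV. \<Sum>a\<in>UNIV. \<phi> (blk a) \<xi> * v $ (a, k) * (X *v w) $ k)"
    by (simp only: inner_vec_def inner_real_def w sum_distrib_right)
  also have "\<dots> = (\<Sum>(a, k)\<in>UNIV. \<phi> (blk a) \<xi> * v $ (a, k) * (X *v w) $ k)"
    by (simp only: sum_pairs prod.case) (rule sum.swap)
  also have "\<dots> = (\<Sum>(a, k)\<in>UNIV. \<Sum>(b, l)\<in>UNIV.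
        v $ (a, k) * v $ (b, l) * (\<phi> (blk a) \<xi> * \<phi> (blk b) \<xi> * X $ k $ l))"
    unfolding Xw sum_distrib_left case_prod_unfold by (intro sum.cong refl) (simp add: mult_ac)
  finally show ?thesis by (simp add: w_def)
qed

text \<open>Expanding both copies of \<open>w\<^sub>v\<close> leaves finitely many terms, and each integrates to an entry of
  the Galerkin matrix weighted by two components of \<open>v\<close>.\<close>

lemma galerkin_quadratic_form:
  fixes blk :: "'m::finite \<Rightarrow> nat" and B :: "'p \<Rightarrow> real ^ 'n ^ 'n" and v :: "real ^ ('m \<times> 'n)"
  assumes int: "\<And>a b. integrable \<mu> (galerkin_integrand \<phi> B (blk a) (blk b))"
  defines "w \<equiv> chaos_vector blk \<phi> v"
  shows "has_bochner_integral \<mu> (\<lambda>\<xi>. w \<xi> \<bullet> (B \<xi> *v w \<xi>)) (v \<bullet> (galerkin_matrix blk \<mu> \<phi> B *v v))"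
proof -
  have "has_bochner_integral \<mu> (\<lambda>\<xi>. w \<xi> \<bullet> (B \<xi> *v w \<xi>))
      (\<Sum>(a, k)\<in>UNIV. \<Sum>(b, l)\<in>UNIV.
        v $ (a, k) * v $ (b, l) * galerkin_matrix blk \<mu> \<phi> B $ (a, k) $ (b, l))"
    unfolding w_def chaos_vector_quadratic_form case_prod_unfold
    by (intro has_bochner_integral_sum has_bochner_integral_mult_right)
       (simp add: has_bochner_integral_iff integrable_galerkin_entry[where blk = blk and B = B, OF int]
          flip: galerkin_matrix_entry[where blk = blk and B = B, OF int])
  also have "(\<Sum>(a, k)\<in>UNIV. \<Sum>(b, l)\<in>UNIV.
        v $ (a, k) * v $ (b, l) * galerkin_matrix blk \<mu> \<phi> B $ (a, k) $ (b, l)) =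
      v \<bullet> (galerkin_matrix blk \<mu> \<phi> B *v v)"
    unfolding inner_vec_def matrix_vector_mult_def vec_lambda_beta inner_real_def sum_distrib_left
      case_prod_unfold prod.collapse
    by (intro sum.cong refl) (simp add: mult_ac)
  finally show ?thesis .
qed

text \<open>Each component of \<open>v\<close> is the inner product in \<open>L\<^sup>2(\<mu>)\<close> of a component of \<open>w\<^sub>v\<close> with a basis
  function, and this depends on \<open>w\<^sub>v\<close> only up to null sets.\<close>

lemma chaos_vector_AE_zero_imp_zero:
  fixes blk :: "'m::finite \<Rightarrow> nat" and v :: "real ^ ('m \<times> 'n::finite)"
  assumes orth: "\<And>a b. has_bochner_integral \<mu> (\<lambda>\<xi>. \<phi> (blk a) \<xi> * \<phi> (blk b) \<xi>)
                          (if a = b then 1 else (0::real))"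
    and zero: "AE \<xi> in \<mu>. chaos_vector blk \<phi> v \<xi> = 0"
  shows "v = 0"
proof -
  have "v $ (b, k) = 0" for b k
  proof -
    have "has_bochner_integral \<mu> (\<lambda>\<xi>. \<Sum>a\<in>UNIV. (\<phi> (blk a) \<xi> * \<phi> (blk b) \<xi>) * v $ (a, k))
        (\<Sum>a\<in>UNIV. (if a = b then 1 else 0) * v $ (a, k))"
      by (intro has_bochner_integral_sum has_bochner_integral_mult_left orth)
    moreover have "(\<Sum>a\<in>UNIV. (if a = b then 1 else 0) * v $ (a, k)) = v $ (b, k)"
      by (simp add: if_distrib[of "\<lambda>c. c * _"] cong: if_cong)
    moreover have "(\<Sum>a\<in>UNIV. (\<phi> (blk a) \<xi> * \<phi> (blk b) \<xi>) * v $ (a, k)) =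
        \<phi> (blk b) \<xi> * chaos_vector blk \<phi> v \<xi> $ k" for \<xi>
      by (simp add: chaos_vector_def sum_distrib_left mult_ac)
    ultimately have "has_bochner_integral \<mu> (\<lambda>\<xi>. \<phi> (blk b) \<xi> * chaos_vector blk \<phi> v \<xi> $ k) (v $ (b, k))"
      by simp
    then have "v $ (b, k) = (LINT \<xi>|\<mu>. \<phi> (blk b) \<xi> * chaos_vector blk \<phi> v \<xi> $ k)"
      by (simp add: has_bochner_integral_iff)
    also have "\<dots> = 0"
      by (rule integral_eq_zero_AE) (use zero in eventually_elim, simp)
    finally show ?thesis .
  qed
  then show ?thesis by (auto simp: vec_eq_iff)
qed

text \<open>The integrand of the quadratic form is nonnegative almost everywhere, so the form can only
  fail to be positive at \<open>v\<close> if the integrand, and with it \<open>w\<^sub>v\<close>, vanishes almost everywhere.\<close>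

lemma positive_definite_galerkin_matrix:
  fixes blk :: "'m::finite \<Rightarrow> nat" and B :: "'p \<Rightarrow> real ^ 'n ^ 'n"
  assumes int: "\<And>a b. integrable \<mu> (galerkin_integrand \<phi> B (blk a) (blk b))"
    and orth: "\<And>a b. has_bochner_integral \<mu> (\<lambda>\<xi>. \<phi> (blk a) \<xi> * \<phi> (blk b) \<xi>)
                          (if a = b then 1 else (0::real))"
    and pos: "AE \<xi> in \<mu>. positive_definite_mat (B \<xi>)"
  shows "positive_definite_mat (galerkin_matrix blk \<mu> \<phi> B)"
  unfolding positive_definite_mat_def
proof (intro allI impI)
  fix v :: "real ^ ('m \<times> 'n)" assume "v \<noteq> 0"
  define w where "w = chaos_vector blk \<phi> v"
  let ?q = "\<lambda>\<xi>. w \<xi> \<bullet> (B \<xi> *v w \<xi>)"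
  have q: "integrable \<mu> ?q" "v \<bullet> (galerkin_matrix blk \<mu> \<phi> B *v v) = integral\<^sup>L \<mu> ?q"
    using galerkin_quadratic_form[where blk = blk and B = B and v = v, OF int]
    by (auto simp: w_def has_bochner_integral_iff)
  have form: "AE \<xi> in \<mu>. 0 \<le> ?q \<xi> \<and> (?q \<xi> = 0 \<longrightarrow> w \<xi> = 0)"
    using pos
  proof eventually_elim
    case (elim \<xi>)
    then show ?case
      by (cases "w \<xi> = 0") (auto simp: positive_definite_mat_def less_le)
  qed
  have nonneg: "AE \<xi> in \<mu>. 0 \<le> ?q \<xi>" using form by eventually_elim simp
  have "integral\<^sup>L \<mu> ?q \<noteq> 0"
  proof
    assume "integral\<^sup>L \<mu> ?q = 0"
    then have "AE \<xi> in \<mu>. ?q \<xi> = 0"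
      using integral_nonneg_eq_0_iff_AE[OF q(1) nonneg] by simp
    with form have "AE \<xi> in \<mu>. w \<xi> = 0" by eventually_elim simp
    then have "v = 0"
      unfolding w_def by (rule chaos_vector_AE_zero_imp_zero[OF orth])
    with \<open>v \<noteq> 0\<close> show False ..
  qed
  moreover have "integral\<^sup>L \<mu> ?q \<ge> 0" by (rule integral_nonneg_AE[OF nonneg])
  ultimately show "v \<bullet> (galerkin_matrix blk \<mu> \<phi> B *v v) > 0" by (simp add: q(2))
qed

theorem theorem2p1:
  fixes \<Omega> :: "real set"
    and \<Theta> :: "(real ^ 'd) set"
    and \<mu> :: "(real ^ 'd) measure"
    and G :: "(real ^ 'n) set"
    and F :: "real ^ 'n \<Rightarrow> real ^ 'd \<Rightarrow> real ^ 'n"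
    and L :: "real ^ 'n \<Rightarrow> real ^ 'd \<Rightarrow> real ^ 'n ^ 'n"
    and lam :: "real ^ 'n \<Rightarrow> real ^ 'd \<Rightarrow> real ^ 'n"
    and \<phi> :: "nat \<Rightarrow> real ^ 'd \<Rightarrow> real"
    and M :: nat
    and blk :: "'m::finite \<Rightarrow> nat"
    and u :: "nat \<Rightarrow> real \<Rightarrow> real \<Rightarrow> real ^ 'n"
    and x t :: real
  defines "u_M \<equiv> gpc_approx M \<phi> u"
  defines "A0 \<equiv> symmetrizer0 L"
    and "A1 \<equiv> symmetrizer1 L lam"
  defines "A0_hat \<equiv> galerkin_matrix blk \<mu> \<phi> (\<lambda>\<xi>. A0 (u_M x t \<xi>) \<xi>)"
    and "A1_hat \<equiv> galerkin_matrix blk \<mu> \<phi> (\<lambda>\<xi>. A1 (u_M x t \<xi>) \<xi>)"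
  assumes prob: "prob_space \<mu>" "sets \<mu> = sets (restrict_space borel \<Theta>)"
    and hyperbolic: "hyperbolic_flux \<mu> G F"
    and eigen: "AE \<xi> in \<mu>. \<forall>U\<in>G. left_eigenvector_matrix (flux_jacobian F U \<xi>) (L U \<xi>) (lam U \<xi>)"
    and basis: "gpc_basis \<mu> \<phi>"
    and blk: "bij_betw blk UNIV {..M}"
    and point: "x \<in> \<Omega>" "t > 0"
    and integrable0: "\<And>i j. i \<le> M \<Longrightarrow> j \<le> M \<Longrightarrow>
          integrable \<mu> (galerkin_integrand \<phi> (\<lambda>\<xi>. A0 (u_M x t \<xi>) \<xi>) i j)"
    and integrable1: "\<And>i j. i \<le> M \<Longrightarrow> j \<le> M \<Longrightarrow>
          integrable \<mu> (galerkin_integrand \<phi> (\<lambda>\<xi>. A1 (u_M x t \<xi>) \<xi>) i j)"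
    and admissible: "\<forall>\<xi>\<in>\<Theta>. u_M x t \<xi> \<in> G"
  shows "symmetric_mat A0_hat \<and> positive_definite_mat A0_hat \<and> symmetric_mat A1_hat \<and>
         symmetrically_hyperbolic A0_hat A1_hat"
proof -
  have range: "blk a \<le> M" and inj: "inj blk" for a
    using blk by (auto simp: bij_betw_def)
  \<comment> \<open>Admissibility is known only on \<open>\<Theta>\<close>; it holds almost surely because \<open>\<Theta>\<close> carries \<open>\<mu>\<close>.\<close>
  have "space \<mu> = \<Theta>"
    using sets_eq_imp_space_eq[OF prob(2)] by (simp add: space_restrict_space)
  with admissible have "AE \<xi> in \<mu>. u_M x t \<xi> \<in> G" by (intro AE_I2) auto
  with eigen have pos: "AE \<xi> in \<mu>. positive_definite_mat (A0 (u_M x t \<xi>) \<xi>)"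
    by eventually_elim
      (auto simp: A0_def left_eigenvector_matrix_def intro!: positive_definite_symmetrizer0)
  have "\<forall>i j. has_bochner_integral \<mu> (\<lambda>\<xi>. \<phi> i \<xi> * \<phi> j \<xi>) (if i = j then 1 else 0)"
    using basis unfolding gpc_basis_def by (elim conjE)
  from this[rule_format, of "blk a" "blk b" for a b]
  have orth: "has_bochner_integral \<mu> (\<lambda>\<xi>. \<phi> (blk a) \<xi> * \<phi> (blk b) \<xi>) (if a = b then 1 else 0)"
    for a b
    by (simp only: inj_eq[OF inj])
  note int0 = integrable0[OF range range] and int1 = integrable1[OF range range]
  have "symmetric_mat A0_hat"
    unfolding A0_hat_def
    by (rule symmetric_galerkin_matrix[OF int0]) (simp add: A0_def symmetric_symmetrizer0)
  moreover have "positive_definite_mat A0_hat"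
    unfolding A0_hat_def by (rule positive_definite_galerkin_matrix[OF int0 orth pos])
  moreover have "symmetric_mat A1_hat"
    unfolding A1_hat_def
    by (rule symmetric_galerkin_matrix[OF int1]) (simp add: A1_def symmetric_symmetrizer1)
  ultimately show ?thesis by (simp add: symmetrically_hyperbolic_def)
qed

end
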